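(* For every integer $a \geq 1$ there is a constant $c$ (depending only on $a$) such that for every integer $n > c$ there is a positive integer $x$ with $x > 1$, $x \in Z_n^*$ and $x + 2a \in Z_n^*$.
   Context: For a positive integer $n$, $Z_n^* = \{x \in \mathbb{N} \mid 1 \leq x < n, \gcd(x,n) = 1\}$ is a set of actual integers in the range $1 \le x < n$ (not residue classes); in particular $x+2a \in Z_n^*$ requires $x + 2a < n$. *)

theory Defs
  imports Main
begin

(* A set of actual integers, not of residue classes. It differs from the library's
   "totatives n" only for n = 1, where it is empty. *)
definition Zstar :: "nat \<Rightarrow> nat set" where
  "Zstar n = {x. 1 \<le> x \<and> x < n \<and> gcd x n = 1}"

end

theory Submission
  imports Defs "HOL-Computational_Algebra.Primes"
begin

text \<open>
  The constant \<open>c = 8 * a\<close> works, with an explicit witness. It suffices to find an \<open>x\<close> with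
  \<open>1 < x < n - 2 * a\<close> such that no prime factor of \<open>n\<close> divides \<open>x\<close> or \<open>x + 2 * a\<close>.

  A prime factor of \<open>n\<close> that does not divide \<open>2 * a\<close> is odd, so it divides neither \<open>2 * a\<close> nor
  \<open>4 * a\<close>: modulo such a prime, \<open>x = 2 * a\<close> is a good choice. Modulo a prime factor of \<open>2 * a\<close>,
  the numbers \<open>x\<close> and \<open>x + 2 * a\<close> coincide and \<open>x\<close> only has to be nonzero. Both demands are met
  by \<open>x = 2 * a + t\<close>, where \<open>t\<close> is coprime to \<open>2 * a\<close> and divisible by every prime factor of \<open>n\<close>
  that does not divide \<open>2 * a\<close> (lemma \<open>coprime_shifted_coprime_part\<close>). Such a \<open>t\<close> exists among
  the divisors of \<open>n\<close> (lemma \<open>obtain_coprime_part\<close>).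

  The size of \<open>x\<close> is the remaining point. If \<open>n\<close> is coprime to \<open>2 * a\<close>, then \<open>x = 2 * a\<close> itself
  is good and \<open>x + 2 * a = 4 * a < n\<close>. Otherwise \<open>t\<close> is a proper divisor of \<open>n\<close>, so
  \<open>t \<le> n / 2\<close> and \<open>x + 2 * a = 4 * a + t < n / 2 + n / 2\<close>.
\<close>

lemma coprime_nat_if_no_common_prime:
  fixes x n :: nat
  assumes "\<And>p. prime p \<Longrightarrow> p dvd x \<Longrightarrow> p dvd n \<Longrightarrow> False"
  shows "coprime x n"
proof (rule ccontr)
  assume "\<not> coprime x n"
  then have "gcd x n \<noteq> 1"
    by (simp add: coprime_iff_gcd_eq_1)
  then obtain p where "prime p" "p dvd gcd x n"
    using prime_factor_nat by blast
  then show False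
    using assms[of p] by simp
qed

text \<open>
  The largest divisor \<open>t\<close> of \<open>n\<close> that is coprime to \<open>b\<close> will do: a prime \<open>p\<close> that divides \<open>n\<close> but
  neither \<open>b\<close> nor \<open>t\<close> would divide the cofactor \<open>n / t\<close>, and then \<open>t * p\<close> would be a larger such
  divisor.
\<close>

lemma obtain_coprime_part:
  fixes b n :: nat
  assumes "n > 0"
  obtains t where "t dvd n" "coprime t b"
    "\<And>p. prime p \<Longrightarrow> p dvd n \<Longrightarrow> \<not> p dvd b \<Longrightarrow> p dvd t"
proof -
  define D where "D = {d. d dvd n \<and> coprime d b}"
  define t where "t = Max D"
  have fin: "finite D"
    using assms unfolding D_def by (auto intro: finite_subset[OF _ finite_divisors_nat])
  have "1 \<in> D"
    by (simp add: D_def)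
  then have "t \<in> D"
    unfolding t_def using fin Max_in by blast
  then have t: "t dvd n" "coprime t b"
    by (simp_all add: D_def)
  have "p dvd t" if p: "prime p" "p dvd n" "\<not> p dvd b" for p
  proof (rule ccontr)
    assume "\<not> p dvd t"
    obtain m where m: "n = t * m"
      using t(1) by (elim dvdE)
    have "p dvd m"
      using p \<open>\<not> p dvd t\<close> by (simp add: m prime_dvd_mult_iff)
    moreover have "coprime p b"
      using p by (simp add: prime_imp_coprime)
    ultimately have "t * p \<in> D"
      using t by (simp add: D_def m)
    then have "t * p \<le> t"
      unfolding t_def using fin by simp
    moreover have "t > 0"
      using t(1) assms by (simp add: dvd_pos_nat)
    ultimately show False
      using prime_gt_1_nat[OF p(1)] by simp
  qed
  with t show thesis
    by (rule that)
qed

lemma prime_not_dvd_double_of_even: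
  fixes p b :: nat
  assumes "prime p" "even b" "\<not> p dvd b"
  shows "\<not> p dvd 2 * b"
proof
  assume "p dvd 2 * b"
  with assms have "p dvd 2"
    by (simp add: prime_dvd_mult_iff)
  then have "p dvd b"
    using assms(2) by (rule dvd_trans)
  with assms(3) show False ..
qed

text \<open>
  The local conditions: a prime factor of \<open>n\<close> that divides \<open>t\<close> sees \<open>b + t\<close> and \<open>2 * b + t\<close> as \<open>b\<close>
  and \<open>2 * b\<close>; any other one divides \<open>b\<close> and sees both numbers as \<open>t\<close>.
\<close>

lemma coprime_shifted_coprime_part:
  fixes b n t :: nat
  assumes "even b" "coprime t b"
    and cover: "\<And>p. prime p \<Longrightarrow> p dvd n \<Longrightarrow> \<not> p dvd b \<Longrightarrow> p dvd t"
  shows "coprime (b + t) n" and "coprime (2 * b + t) n"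
proof -
  have nondvd: "\<not> p dvd b + t \<and> \<not> p dvd 2 * b + t" if p: "prime p" "p dvd n" for p
  proof (cases "p dvd b")
    case True
    then have "\<not> p dvd t"
      using assms(2) p(1) not_prime_unit coprime_common_divisor by blast
    with True show ?thesis
      by (simp add: dvd_add_right_iff)
  next
    case False
    then have "p dvd t"
      using cover p by blast
    with False show ?thesis
      using prime_not_dvd_double_of_even[OF p(1) assms(1) False] by (simp add: dvd_add_left_iff)
  qed
  show "coprime (b + t) n" "coprime (2 * b + t) n"
    using nondvd by (auto intro: coprime_nat_if_no_common_prime)
qed

lemma proper_divisor_le_half:
  fixes t n :: nat
  assumes "t dvd n" "t \<noteq> n" "n > 0"
  shows "2 * t \<le> n"
proof -
  obtain m where m: "n = t * m"
    using assms(1) by (elim dvdE)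
  with assms(2,3) have "m \<noteq> 0" "m \<noteq> 1"
    by auto
  then have "2 \<le> m"
    by simp
  then show ?thesis
    by (simp add: m mult.commute)
qed

theorem theorem1:
  fixes a :: nat
  assumes "a \<ge> 1"
  shows "\<exists>c::nat. \<forall>n::nat. n > c \<longrightarrow> (\<exists>x::nat. x > 1 \<and> x \<in> Zstar n \<and> x + 2 * a \<in> Zstar n)"
proof (rule exI[of _ "8 * a"], intro allI impI)
  fix n :: nat
  assume n: "n > 8 * a"
  show "\<exists>x. x > 1 \<and> x \<in> Zstar n \<and> x + 2 * a \<in> Zstar n"
  proof (cases "coprime n (2 * a)")
    case True
    then have "coprime (2 * a) n" "coprime (4 * a) n"
      \<comment> \<open>\<open>4 * a\<close> has the same prime factors as \<open>2 * a\<close>.\<close>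
      using coprime_mult_left_iff[of 2 "2 * a" n] by (simp_all add: coprime_commute)
    then have "2 * a > 1 \<and> 2 * a \<in> Zstar n \<and> 2 * a + 2 * a \<in> Zstar n"
      using assms n by (simp add: Zstar_def coprime_iff_gcd_eq_1)
    then show ?thesis ..
  next
    case False
    obtain t where t: "t dvd n" "coprime t (2 * a)"
      and cover: "\<And>p. prime p \<Longrightarrow> p dvd n \<Longrightarrow> \<not> p dvd 2 * a \<Longrightarrow> p dvd t"
      using obtain_coprime_part[of n "2 * a"] n by auto
    have "t \<noteq> n"
      using False t(2) by auto
    then have half: "2 * t \<le> n"
      using proper_divisor_le_half[OF t(1)] n by simp
    have "coprime (2 * a + t) n" "coprime (2 * (2 * a) + t) n"
      using coprime_shifted_coprime_part[OF _ t(2) cover] by simp_all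
    then have "2 * a + t > 1 \<and> 2 * a + t \<in> Zstar n \<and> (2 * a + t) + 2 * a \<in> Zstar n"
      using assms n half by (simp add: Zstar_def coprime_iff_gcd_eq_1 algebra_simps)
    then show ?thesis ..
  qed
qed

end
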